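(* Let $\mu\geq 2$ be an integer and let $p$ be a positive integer. Let $I_0,\ldots,I_{p-1}\subseteq\mathbb{R}$ be intervals and let $f_i:I_i\to I_{i+1\,(\mathrm{mod}\,p)}$, $i=0,\ldots,p-1$, be maps with $f_i\in\mathcal{C}^{\mu+1}(I_i)$. For $0\le m\le p-1$ let $F_m:I_m\to I_m$ be the cyclic composition $$F_m=f_{m-1}\circ\cdots\circ f_0\circ f_{p-1}\circ\cdots\circ f_m$$ (so $F_0=f_{p-1}\circ\cdots\circ f_0$). Let $j\in\{0,\ldots,p-1\}$ be fixed and suppose that: 1. there exist points $a_m\in I_m$, $0\le m\le p-1$, with $a_{m+1\,(\mathrm{mod}\,p)}=f_m(a_m)$ for every $m$, that are fixed points of the compositions: $F_m(a_m)=a_m$ for every $0\le m\le p-1$; 2. $\partial_xF_j(x)|_{x=a_j}=\prod_{i=0}^{p-1}\partial_xf_i(a_i)=1$; 3. $\partial_{x^i}F_j(x)|_{x=a_j}=0$ for every $2\leq i\leq\mu$; 4. $\partial_{x^{\mu+1}}F_j(x)|_{x=a_j}\neq 0$. Then for every $0\leq m\leq p-1$, $$\partial_{x^i}F_m(x)|_{x=a_m}=0\quad\text{for every }2\leq i\leq\mu,\qquad\text{and}\qquad\partial_{x^{\mu+1}}F_m(x)|_{x=a_m}\neq 0.$$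
   Context: Intervals are real intervals, not necessarily compact, possibly all of $\mathbb{R}$. The maps may depend on a parameter $\Lambda$, which is fixed in this statement and suppressed from the notation; compositions and derivatives are in the dynamic variable $x$. $\mathcal{C}^{s}(I)$ is the set of functions on $I$ with continuous derivatives up to order $s$. $\partial_{x^i}$ denotes the $i$-th derivative with respect to $x$. *)

theory Defs
  imports "HOL-Analysis.Analysis"
begin

(* A singleton or empty set is excluded: derivatives of functions on it have no meaning. *)
definition proper_interval :: "real set \<Rightarrow> bool" where
  "proper_interval I \<longleftrightarrow> is_interval I \<and> (\<exists>x\<in>I. \<exists>y\<in>I. x < y)"

(* All derivatives are taken relative to I, hence one-sided at endpoints belonging to I;
   for x in I the value depends only on f restricted to I. *)
definition nth_deriv_on :: "real set \<Rightarrow> nat \<Rightarrow> (real \<Rightarrow> real) \<Rightarrow> real \<Rightarrow> real" where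
  "nth_deriv_on I n = ((\<lambda>g x. vector_derivative g (at x within I)) ^^ n)"

definition Ck_on :: "nat \<Rightarrow> real set \<Rightarrow> (real \<Rightarrow> real) set" where
  "Ck_on s I = {f. (\<forall>k<s. nth_deriv_on I k f differentiable_on I) \<and>
                   (\<forall>k\<le>s. continuous_on I (nth_deriv_on I k f))}"

(* fold applies f m first and f (m - 1) last (f (p - 1) last if m = 0). *)
definition cyclic_comp :: "nat \<Rightarrow> (nat \<Rightarrow> real \<Rightarrow> real) \<Rightarrow> nat \<Rightarrow> real \<Rightarrow> real" where
  "cyclic_comp p f m = fold f ([m..<p] @ [0..<m])"

end

theory Submission
  imports Defs
begin

text \<open>
  Write \<open>F\<^sub>m\<close> for the cyclic composition starting at \<open>f\<^sub>m\<close> and \<open>k = \<mu> + 1\<close>. Derivative \<open>1\<close> at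
  the fixed point \<open>a\<^sub>m\<close>, vanishing derivatives of the orders from \<open>2\<close> to \<open>\<mu>\<close> and a nonzero derivative of order
  \<open>k\<close> together say that \<open>F\<^sub>m\<close> is in contact of order exactly \<open>k\<close> with the identity at \<open>a\<^sub>m\<close>:
  \<open>F\<^sub>m x = x + c (x - a\<^sub>m)\<^sup>k + o((x - a\<^sub>m)\<^sup>k)\<close> with \<open>c \<noteq> 0\<close>. This formulation, which mentions no higher
  derivative, is easy to push around the cycle, because \<open>f\<^sub>m \<circ> F\<^sub>m = F\<^bsub>m+1\<^esub> \<circ> f\<^sub>m\<close>
  (lemma \<open>cyclic_comp_conjugate\<close>) and every \<open>f\<^sub>m\<close> has slope \<open>s \<noteq> 0\<close> at \<open>a\<^sub>m\<close>, the product of the slopes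
  being \<open>1\<close>. Indeed, for \<open>y = f\<^sub>m x\<close>,
  \<open>F\<^bsub>m+1\<^esub> y - y = f\<^sub>m (F\<^sub>m x) - f\<^sub>m x = s c (x - a\<^sub>m)\<^sup>k + o((x - a\<^sub>m)\<^sup>k)\<close> while
  \<open>y - a\<^bsub>m+1\<^esub> = s (x - a\<^sub>m) + o(x - a\<^sub>m)\<close>,
  so the constant for \<open>F\<^bsub>m+1\<^esub>\<close> is \<open>s c / s\<^sup>k \<noteq> 0\<close>.

  One point needs care. The image of \<open>I\<^sub>m\<close> under \<open>f\<^sub>m\<close> may reach only one side of \<open>a\<^bsub>m+1\<^esub>\<close>, so the
  computation controls \<open>F\<^bsub>m+1\<^esub>\<close> along this image only, not in a full neighbourhood in \<open>I\<^bsub>m+1\<^esub>\<close>. But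
  \<open>F\<^bsub>m+1\<^esub>\<close> is \<open>k\<close> times continuously differentiable, hence has a Taylor expansion with Peano remainder
  (lemma \<open>Taylor_Peano_within\<close>), and its coefficients are already determined by the limit along any
  nontrivial filter converging to \<open>a\<^bsub>m+1\<^esub>\<close> through other points of the interval. Lemma \<open>contact_with_identity_iff\<close> is therefore stated for
  arbitrary filters: it both translates the contact condition into derivatives and carries it from
  the image to the whole interval.
\<close>

section \<open>Derivatives relative to an interval\<close>

lemma at_within_proper_interval_neq_bot:
  assumes "proper_interval I" "x \<in> I"
  shows "at x within I \<noteq> bot"
proof -
  have "x islimpt I"
    using assms connected_imp_perfect[of I x]
    by (force simp: proper_interval_def is_interval_connected_1)
  then show ?thesis
    by (simp add: trivial_limit_within)
qed

lemma nth_deriv_on_0 [simp]: "nth_deriv_on I 0 f = f"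
  by (simp add: nth_deriv_on_def)

lemma nth_deriv_on_Suc:
  "nth_deriv_on I (Suc n) f = nth_deriv_on I n (\<lambda>x. vector_derivative f (at x within I))"
  by (simp add: nth_deriv_on_def funpow_Suc_right del: funpow.simps)

lemma nth_deriv_on_cong:
  assumes "\<And>x. x \<in> I \<Longrightarrow> f x = g x" "x \<in> I"
  shows "nth_deriv_on I n f x = nth_deriv_on I n g x"
  using assms
proof (induction n arbitrary: f g x)
  case (Suc n)
  have "vector_derivative f (at y within I) = vector_derivative g (at y within I)"
    if "y \<in> I" for y
    using Suc.prems(1) that
    by (intro vector_derivative_cong_eq) (simp_all add: always_eventually)
  then show ?case
    unfolding nth_deriv_on_Suc by (rule Suc.IH[OF _ Suc.prems(2)])
qed simp

lemma Ck_on_0: "f \<in> Ck_on 0 I \<longleftrightarrow> continuous_on I f"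
  by (simp add: Ck_on_def)

lemma Ck_on_cong:
  assumes "\<And>x. x \<in> I \<Longrightarrow> f x = g x"
  shows "f \<in> Ck_on s I \<longleftrightarrow> g \<in> Ck_on s I"
proof -
  have *: "nth_deriv_on I k f x = nth_deriv_on I k g x" if "x \<in> I" for x k
    using nth_deriv_on_cong[OF assms that] .
  have transform: "v differentiable_on I" if "u differentiable_on I" "\<And>x. x \<in> I \<Longrightarrow> u x = v x"
    for u v :: "real \<Rightarrow> real"
    using that unfolding differentiable_on_def
    by (meson differentiable_transform_within zero_less_one)
  have "nth_deriv_on I k f differentiable_on I \<longleftrightarrow> nth_deriv_on I k g differentiable_on I" for k
    by (rule iffI; erule transform; simp add: *)
  moreover have "continuous_on I (nth_deriv_on I k f) \<longleftrightarrow> continuous_on I (nth_deriv_on I k g)" for k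
    by (rule continuous_on_cong[OF refl *])
  ultimately show ?thesis
    by (simp add: Ck_on_def)
qed

lemma nth_deriv_on_Suc_eq:
  assumes "proper_interval I" "x \<in> I"
    and "\<And>x. x \<in> I \<Longrightarrow> (f has_real_derivative f' x) (at x within I)"
  shows "nth_deriv_on I (Suc n) f x = nth_deriv_on I n f' x"
  unfolding nth_deriv_on_Suc
proof (rule nth_deriv_on_cong[OF _ assms(2)])
  fix y assume "y \<in> I"
  then show "vector_derivative f (at y within I) = f' y"
    using assms(3) at_within_proper_interval_neq_bot[OF assms(1)]
    by (simp add: vector_derivative_within has_real_derivative_iff_has_vector_derivative)
qed

text \<open>
  This recursive description replaces the iterated derivative operator by a derivative that may be
  named freely, so that closure properties of \<open>Ck_on\<close> follow by induction from the
  rules of differentiation.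
\<close>
lemma Ck_on_Suc_iff:
  assumes "proper_interval I"
  shows "f \<in> Ck_on (Suc s) I \<longleftrightarrow>
    (\<exists>f'. (\<forall>x\<in>I. (f has_real_derivative f' x) (at x within I)) \<and> f' \<in> Ck_on s I)"
    (is "?L \<longleftrightarrow> ?R")
proof -
  let ?D = "\<lambda>x. vector_derivative f (at x within I)"
  have L: "?L \<longleftrightarrow> f differentiable_on I \<and> continuous_on I f \<and> ?D \<in> Ck_on s I"
    unfolding Ck_on_def mem_Collect_eq less_Suc_eq_le[symmetric] All_less_Suc2 nth_deriv_on_Suc
      nth_deriv_on_0 by blast
  show ?thesis
  proof
    assume ?L
    then have "\<forall>x\<in>I. (f has_real_derivative ?D x) (at x within I)"
      using L unfolding has_real_derivative_iff_has_vector_derivative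
      by (simp add: differentiable_on_def vector_derivative_works[symmetric])
    with \<open>?L\<close> L show ?R
      by (intro exI[of _ ?D]) simp
  next
    assume ?R
    then obtain f' where f': "\<And>x. x \<in> I \<Longrightarrow> (f has_real_derivative f' x) (at x within I)"
      and "f' \<in> Ck_on s I" by blast
    moreover have "?D x = f' x" if "x \<in> I" for x
      using nth_deriv_on_Suc_eq[OF assms that f', of 0] by (simp add: nth_deriv_on_Suc)
    moreover have "f differentiable_on I"
      using f' real_differentiable_def unfolding differentiable_on_def by blast
    ultimately show ?L
      using L Ck_on_cong[of I ?D f' s] differentiable_imp_continuous_on[of f I] by simp
  qed
qed

lemma Ck_on_imp_continuous_on: "f \<in> Ck_on s I \<Longrightarrow> continuous_on I f"
  by (force simp: Ck_on_def)

lemma Ck_on_mono: "f \<in> Ck_on s I \<Longrightarrow> r \<le> s \<Longrightarrow> f \<in> Ck_on r I"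
  by (auto simp: Ck_on_def)

lemma Ck_on_const: "proper_interval I \<Longrightarrow> (\<lambda>_. c) \<in> Ck_on s I"
proof (induction s arbitrary: c)
  case (Suc s)
  then show ?case
    unfolding Ck_on_Suc_iff[OF Suc.prems] by (intro exI[of _ "\<lambda>_. 0"]) auto
qed (simp add: Ck_on_0)

lemma Ck_on_ident:
  assumes "proper_interval I"
  shows "(\<lambda>x. x) \<in> Ck_on s I"
proof (cases s)
  case (Suc r)
  then show ?thesis
    using assms Ck_on_const by (auto simp: Ck_on_Suc_iff intro!: exI[of _ "\<lambda>_. 1"])
qed (simp add: Ck_on_0)

lemma Ck_on_add:
  assumes "proper_interval I" "f \<in> Ck_on s I" "g \<in> Ck_on s I"
  shows "(\<lambda>x. f x + g x) \<in> Ck_on s I"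
  using assms(2,3)
proof (induction s arbitrary: f g)
  case (Suc s)
  from Suc.prems obtain f' g' where
    "\<And>x. x \<in> I \<Longrightarrow> (f has_real_derivative f' x) (at x within I)" "f' \<in> Ck_on s I"
    "\<And>x. x \<in> I \<Longrightarrow> (g has_real_derivative g' x) (at x within I)" "g' \<in> Ck_on s I"
    unfolding Ck_on_Suc_iff[OF assms(1)] by metis
  then show ?case
    unfolding Ck_on_Suc_iff[OF assms(1)]
    by (intro exI[of _ "\<lambda>x. f' x + g' x"]) (auto intro!: DERIV_add Suc.IH)
qed (auto simp: Ck_on_0 intro: continuous_intros)

lemma Ck_on_mult:
  assumes "proper_interval I" "f \<in> Ck_on s I" "g \<in> Ck_on s I"
  shows "(\<lambda>x. f x * g x) \<in> Ck_on s I"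
  using assms(2,3)
proof (induction s arbitrary: f g)
  case (Suc s)
  from Suc.prems obtain f' g' where
    "\<And>x. x \<in> I \<Longrightarrow> (f has_real_derivative f' x) (at x within I)" "f' \<in> Ck_on s I"
    "\<And>x. x \<in> I \<Longrightarrow> (g has_real_derivative g' x) (at x within I)" "g' \<in> Ck_on s I"
    unfolding Ck_on_Suc_iff[OF assms(1)] by metis
  moreover have "f \<in> Ck_on s I" "g \<in> Ck_on s I"
    using Suc.prems Ck_on_mono by (meson le_SucI order_refl)+
  ultimately show ?case
    unfolding Ck_on_Suc_iff[OF assms(1)]
    by (intro exI[of _ "\<lambda>x. f' x * g x + g' x * f x"])
       (auto intro!: DERIV_mult Suc.IH Ck_on_add assms(1))
qed (auto simp: Ck_on_0 intro: continuous_intros)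

lemma Ck_on_compose:
  assumes "proper_interval I" "proper_interval J" "f \<in> Ck_on s I" "g \<in> Ck_on s J" "f \<in> I \<rightarrow> J"
  shows "(\<lambda>x. g (f x)) \<in> Ck_on s I"
  using assms(3,4)
proof (induction s arbitrary: g)
  case 0
  then show ?case
    using assms(5) unfolding Ck_on_0 by (intro continuous_on_compose2[of J g I f]) auto
next
  case (Suc s)
  obtain f' where
    f': "\<And>x. x \<in> I \<Longrightarrow> (f has_real_derivative f' x) (at x within I)" "f' \<in> Ck_on s I"
    using Suc.prems(1) unfolding Ck_on_Suc_iff[OF assms(1)] by blast
  obtain g' where
    g': "\<And>x. x \<in> J \<Longrightarrow> (g has_real_derivative g' x) (at x within J)" "g' \<in> Ck_on s J"
    using Suc.prems(2) unfolding Ck_on_Suc_iff[OF assms(2)] by blast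
  have "f \<in> Ck_on s I"
    using Suc.prems Ck_on_mono by (meson le_SucI order_refl)
  then have "(\<lambda>x. g' (f x) * f' x) \<in> Ck_on s I"
    by (rule Ck_on_mult[OF assms(1) Suc.IH[OF _ g'(2)] f'(2)])
  moreover have "((\<lambda>x. g (f x)) has_real_derivative g' (f x) * f' x) (at x within I)"
    if "x \<in> I" for x
  proof -
    have "(g has_real_derivative g' (f x)) (at (f x) within f ` I)"
      using DERIV_subset[OF g'(1)] assms(5) that by blast
    then show ?thesis
      using DERIV_image_chain[of g "g' (f x)" f x I, OF _ f'(1)[OF that]] by (simp add: o_def)
  qed
  ultimately show ?case
    unfolding Ck_on_Suc_iff[OF assms(1)] by (intro exI[of _ "\<lambda>x. g' (f x) * f' x"]) simp
qed

section \<open>Taylor expansion and contact with the identity\<close>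

text \<open>
  The derivative of the remainder of order \<open>n + 1\<close> is the remainder of order \<open>n\<close> of the derivative, so
  the mean value inequality on the segment from \<open>a\<close> to \<open>x\<close> gains one power of \<open>x - a\<close> in each
  induction step.
\<close>
lemma Taylor_Peano_within:
  assumes "proper_interval I" "a \<in> I" "f \<in> Ck_on n I"
  shows "((\<lambda>x. (f x - (\<Sum>i\<le>n. nth_deriv_on I i f a / fact i * (x - a) ^ i)) / (x - a) ^ n)
           \<longlongrightarrow> 0) (at a within I)"
  using assms(3)
proof (induction n arbitrary: f)
  case 0
  then have "(f \<longlongrightarrow> f a) (at a within I)"
    using assms(2) by (simp add: Ck_on_0 continuous_on)
  then show ?case
    by (simp add: LIM_zero)
next
  case (Suc n)
  from Suc.prems obtain f' where
    f': "\<And>x. x \<in> I \<Longrightarrow> (f has_real_derivative f' x) (at x within I)" "f' \<in> Ck_on n I"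
    unfolding Ck_on_Suc_iff[OF assms(1)] by metis
  define R' where "R' x = f' x - (\<Sum>i\<le>n. nth_deriv_on I i f' a / fact i * (x - a) ^ i)" for x
  define R where "R x = f x - (\<Sum>i\<le>Suc n. nth_deriv_on I i f a / fact i * (x - a) ^ i)" for x
  have R_eq: "R x = f x - (f a + (\<Sum>i\<le>n. nth_deriv_on I i f' a / fact (Suc i) * (x - a) ^ Suc i))" for x
    unfolding R_def sum.atMost_Suc_shift
    by (simp add: nth_deriv_on_Suc_eq[OF assms(1,2) f'(1)] del: power_Suc fact_Suc)
  have R': "(R has_real_derivative R' x) (at x within I)" if "x \<in> I" for x
    unfolding R_eq[abs_def] R'_def
    by (rule derivative_eq_intros f'(1) that refl)+
       (auto intro!: sum.cong simp: field_simps simp del: of_nat_Suc)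
  have "((\<lambda>x. R x / (x - a) ^ Suc n) \<longlongrightarrow> 0) (at a within I)"
    unfolding tendsto_iff
  proof (intro allI impI)
    fix e :: real assume "e > 0"
    have "((\<lambda>x. R' x / (x - a) ^ n) \<longlongrightarrow> 0) (at a within I)"
      unfolding R'_def using Suc.IH f'(2) .
    then have "\<forall>\<^sub>F x in at a within I. dist (R' x / (x - a) ^ n) 0 < e / 2"
      using \<open>e > 0\<close> unfolding tendsto_iff by (meson half_gt_zero)
    then obtain d where "d > 0" and
      d: "\<And>x. \<lbrakk>x \<in> I; x \<noteq> a; dist x a < d\<rbrakk> \<Longrightarrow> \<bar>R' x / (x - a) ^ n\<bar> < e / 2"
      unfolding eventually_at by (auto simp: dist_real_def)
    \<comment> \<open>The point \<open>a\<close> itself lies on the segment, where the quotient says nothing about \<open>R'\<close>.\<close>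
    have "R' a = 0"
      by (simp add: R'_def sum.atMost_shift)
    have bound: "\<bar>R' x\<bar> \<le> e / 2 * \<bar>x - a\<bar> ^ n" if "x \<in> I" "dist x a < d" for x
    proof (cases "x = a")
      case False
      with d[OF that(1) False that(2)] show ?thesis
        by (simp add: abs_divide power_abs field_simps)
    qed (use \<open>R' a = 0\<close> \<open>e > 0\<close> in simp)
    have "dist (R x / (x - a) ^ Suc n) 0 < e" if x: "x \<in> I" "x \<noteq> a" "dist x a < d" for x
    proof -
      let ?S = "closed_segment a x"
      have seg: "?S \<subseteq> I"
        using assms(1,2) x(1) closed_segment_subset
        by (auto simp: proper_interval_def is_interval_convex_1)
      have near: "\<bar>z - a\<bar> \<le> \<bar>x - a\<bar>" if "z \<in> ?S" for z
        using that by (auto simp: closed_segment_eq_real_ivl split: if_splits)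
      have "norm (R x - R a) \<le> e / 2 * \<bar>x - a\<bar> ^ n * norm (x - a)"
      proof (rule field_differentiable_bound[where S = ?S and f' = R'])
        fix z assume z: "z \<in> ?S"
        show "(R has_real_derivative R' z) (at z within ?S)"
          using R' seg z DERIV_subset by blast
        have "\<bar>R' z\<bar> \<le> e / 2 * \<bar>z - a\<bar> ^ n"
          using z seg near[OF z] x(3) by (intro bound) (auto simp: dist_real_def)
        also have "\<dots> \<le> e / 2 * \<bar>x - a\<bar> ^ n"
          using near[OF z] \<open>e > 0\<close> by (intro mult_left_mono power_mono) auto
        finally show "norm (R' z) \<le> e / 2 * \<bar>x - a\<bar> ^ n" by simp
      qed auto
      moreover have "R a = 0"
        by (simp add: R_eq)
      moreover have "e / 2 * \<bar>x - a\<bar> ^ Suc n < e * \<bar>x - a\<bar> ^ Suc n"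
        using \<open>e > 0\<close> x(2) by (intro mult_strict_right_mono) auto
      ultimately have "\<bar>R x\<bar> < e * \<bar>x - a\<bar> ^ Suc n"
        by (simp add: mult_ac)
      then show ?thesis
        using x(2) by (simp add: abs_divide power_abs pos_divide_less_eq del: power_Suc)
    qed
    with \<open>d > 0\<close> show "\<forall>\<^sub>F x in at a within I. dist (R x / (x - a) ^ Suc n) 0 < e"
      unfolding eventually_at by blast
  qed
  then show ?case
    unfolding R_def .
qed

text \<open>
  Multiplying the convergent quotient by \<open>(y - b) ^ k\<close> makes it tend to \<open>0\<close>, which forces the constant
  coefficient to vanish; one factor \<open>y - b\<close> then cancels and the argument repeats.
  The filter may be much finer than the punctured neighbourhoods of \<open>b\<close>: that is what allows
  coefficients to be read off along the image of a map.
\<close>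
lemma polynomial_quotient_limit_unique:
  fixes q :: "nat \<Rightarrow> real"
  assumes "E \<noteq> bot" "E \<le> at b"
    and "((\<lambda>y. (\<Sum>i\<le>k. q i * (y - b) ^ i) / (y - b) ^ k) \<longlongrightarrow> L) E"
  shows "(\<forall>i<k. q i = 0) \<and> q k = L"
  using assms(3)
proof (induction k arbitrary: q)
  case 0
  then show ?case
    using assms(1) tendsto_unique[OF assms(1) tendsto_const[of "q 0"]] by simp
next
  case (Suc k)
  let ?P = "\<lambda>y. \<Sum>i\<le>Suc k. q i * (y - b) ^ i"
  have ne: "\<forall>\<^sub>F y in E. y \<noteq> b"
    using assms(2) by (rule filter_leD) (simp add: eventually_at_filter)
  have "((\<lambda>y. y - b) \<longlongrightarrow> 0) E"
    by (rule tendsto_mono[OF assms(2) LIM_zero[OF tendsto_ident_at]])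
  note pow = tendsto_power[OF this]
  have "((\<lambda>y. ?P y / (y - b) ^ Suc k * (y - b) ^ Suc k) \<longlongrightarrow> L * 0 ^ Suc k) E"
    by (intro tendsto_mult Suc.prems pow)
  moreover have "\<forall>\<^sub>F y in E. ?P y / (y - b) ^ Suc k * (y - b) ^ Suc k = ?P y"
    using ne by eventually_elim (simp del: sum.atMost_Suc power_Suc)
  ultimately have "(?P \<longlongrightarrow> L * 0 ^ Suc k) E"
    by (rule Lim_transform_eventually)
  then have "(?P \<longlongrightarrow> 0) E"
    by (simp del: sum.atMost_Suc)
  moreover have "(?P \<longlongrightarrow> (\<Sum>i\<le>Suc k. q i * 0 ^ i)) E"
    by (intro tendsto_sum tendsto_mult tendsto_const pow)
  then have "(?P \<longlongrightarrow> q 0) E"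
    by (simp add: sum.atMost_Suc_shift del: sum.atMost_Suc)
  ultimately have "q 0 = 0"
    using tendsto_unique[OF assms(1)] by blast
  have "((\<lambda>y. (\<Sum>i\<le>k. q (Suc i) * (y - b) ^ i) / (y - b) ^ k) \<longlongrightarrow> L) E"
  proof (rule Lim_transform_eventually[OF Suc.prems])
    have "?P y = (y - b) * (\<Sum>i\<le>k. q (Suc i) * (y - b) ^ i)" for y
      unfolding sum.atMost_Suc_shift sum_distrib_left using \<open>q 0 = 0\<close> by (simp add: mult_ac)
    with ne show "\<forall>\<^sub>F y in E. ?P y / (y - b) ^ Suc k = (\<Sum>i\<le>k. q (Suc i) * (y - b) ^ i) / (y - b) ^ k"
      by (simp add: eventually_mono del: sum.atMost_Suc)
  qed
  from Suc.IH[OF this] \<open>q 0 = 0\<close> show ?case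
    by (auto simp: less_Suc_eq_0_disj)
qed

text \<open>
  The right-hand side does not depend on the filter. Applying the equivalence once to the image of a
  punctured neighbourhood and once to the full punctured neighbourhood extends a limit from the former
  to the latter.
\<close>
lemma contact_with_identity_iff:
  assumes "proper_interval J" "b \<in> J" "G \<in> Ck_on k J" "G b = b" "k \<ge> 2"
    and "E \<noteq> bot" "E \<le> at b within J"
  shows "((\<lambda>y. (G y - y) / (y - b) ^ k) \<longlongrightarrow> L) E \<longleftrightarrow>
    nth_deriv_on J 1 G b = 1 \<and> (\<forall>i. 2 \<le> i \<and> i < k \<longrightarrow> nth_deriv_on J i G b = 0) \<and>
    nth_deriv_on J k G b / fact k = L"
proof -
  \<comment> \<open>The Taylor coefficients at \<open>b\<close> of \<open>G\<close> minus those of the identity.\<close>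
  define q where "q i = nth_deriv_on J i G b / fact i - (if i = 0 then b else if i = 1 then 1 else 0)" for i
  let ?Q = "\<lambda>y. (\<Sum>i\<le>k. q i * (y - b) ^ i) / (y - b) ^ k"
  have id_eq: "(\<Sum>i\<le>k. (if i = 0 then b else if i = 1 then 1 else 0) * (y - b) ^ i) = y" for y
  proof -
    have "(\<Sum>i\<le>k. (if i = 0 then b else if i = 1 then 1 else 0) * (y - b) ^ i)
        = (\<Sum>i\<in>{0,1}. (if i = 0 then b else if i = 1 then 1 else 0) * (y - b) ^ i)"
      using assms(5) by (intro sum.mono_neutral_right) auto
    then show ?thesis by simp
  qed
  have "((\<lambda>y. (G y - (\<Sum>i\<le>k. nth_deriv_on J i G b / fact i * (y - b) ^ i)) / (y - b) ^ k) \<longlongrightarrow> 0) E"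
    by (rule tendsto_mono[OF assms(7) Taylor_Peano_within[OF assms(1-3)]])
  moreover have "(\<lambda>y. (G y - (\<Sum>i\<le>k. nth_deriv_on J i G b / fact i * (y - b) ^ i)) / (y - b) ^ k)
      = (\<lambda>y. (G y - y) / (y - b) ^ k - ?Q y)"
    unfolding q_def by (simp add: left_diff_distrib sum_subtractf id_eq diff_divide_distrib)
  ultimately have diff: "((\<lambda>y. (G y - y) / (y - b) ^ k - ?Q y) \<longlongrightarrow> 0) E"
    by (simp only:)
  have E: "E \<le> at b"
    by (rule order_trans[OF assms(7) at_le[OF subset_UNIV]])
  have "((\<lambda>y. (G y - y) / (y - b) ^ k) \<longlongrightarrow> L) E \<longleftrightarrow> (?Q \<longlongrightarrow> L) E"
    by (rule Lim_transform_eq[OF diff])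
  also have "\<dots> \<longleftrightarrow> (\<forall>i<k. q i = 0) \<and> q k = L"
  proof
    assume q: "(\<forall>i<k. q i = 0) \<and> q k = L"
    have "\<forall>\<^sub>F y in E. y \<noteq> b"
      using E by (rule filter_leD) (simp add: eventually_at_filter)
    moreover have "(\<Sum>i\<le>k. q i * (y - b) ^ i) = L * (y - b) ^ k" for y
      using q by (cases k) auto
    ultimately have "\<forall>\<^sub>F y in E. L = ?Q y"
      by (simp add: eventually_mono)
    then show "(?Q \<longlongrightarrow> L) E"
      by (rule Lim_transform_eventually[OF tendsto_const])
  qed (rule polynomial_quotient_limit_unique[OF assms(6) E])
  also have "\<dots> \<longleftrightarrow> nth_deriv_on J 1 G b = 1 \<and>
      (\<forall>i. 2 \<le> i \<and> i < k \<longrightarrow> nth_deriv_on J i G b = 0) \<and> nth_deriv_on J k G b / fact k = L"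
  proof -
    have "q 0 = 0" "q 1 = 0 \<longleftrightarrow> nth_deriv_on J 1 G b = 1"
      using assms(4) by (auto simp: q_def)
    moreover have "q i = nth_deriv_on J i G b / fact i" if "i \<ge> 2" for i
      using that by (simp add: q_def)
    moreover have "(\<forall>i<k. q i = 0) \<longleftrightarrow> q 0 = 0 \<and> q 1 = 0 \<and> (\<forall>i. 2 \<le> i \<and> i < k \<longrightarrow> q i = 0)"
    proof (intro iffI allI impI)
      fix i assume q: "q 0 = 0 \<and> q 1 = 0 \<and> (\<forall>i. 2 \<le> i \<and> i < k \<longrightarrow> q i = 0)" and "i < k"
      consider "i = 0" | "i = 1" | "2 \<le> i" by linarith
      then show "q i = 0" using q \<open>i < k\<close> by cases auto
    qed (use assms(5) in auto)
    ultimately show ?thesis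
      using assms(5) by auto
  qed
  finally show ?thesis .
qed

section \<open>Transport of contact along a semiconjugacy\<close>

text \<open>
  Plain differentiability at \<open>a\<close> is too weak for comparing \<open>\<phi> (F x)\<close> with \<open>\<phi> x\<close>, since
  \<open>F x - x\<close> is much smaller than \<open>x - a\<close>. Continuity of the derivative makes the linear
  approximation uniform over pairs of points near \<open>a\<close>.
\<close>
lemma strict_differentiability_within:
  assumes "proper_interval I" "a \<in> I" "\<phi> \<in> Ck_on 1 I" "e > 0"
  obtains d where "d > 0"
    "\<And>x y. \<lbrakk>x \<in> I; y \<in> I; dist x a < d; dist y a < d\<rbrakk> \<Longrightarrow>
       \<bar>\<phi> y - \<phi> x - nth_deriv_on I 1 \<phi> a * (y - x)\<bar> \<le> e * \<bar>y - x\<bar>"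
proof -
  obtain \<phi>' where
    d: "\<And>x. x \<in> I \<Longrightarrow> (\<phi> has_real_derivative \<phi>' x) (at x within I)" and "continuous_on I \<phi>'"
    using assms(3) Ck_on_Suc_iff[OF assms(1), of \<phi> 0] by (auto simp: Ck_on_0)
  have a: "nth_deriv_on I 1 \<phi> a = \<phi>' a"
    using nth_deriv_on_Suc_eq[OF assms(1,2) d, of 0] by simp
  obtain r where "r > 0" and r: "\<And>x. x \<in> I \<Longrightarrow> dist x a < r \<Longrightarrow> dist (\<phi>' x) (\<phi>' a) < e"
    using \<open>continuous_on I \<phi>'\<close> assms(2,4) unfolding continuous_on_iff by blast
  have "\<bar>\<phi> y - \<phi> x - \<phi>' a * (y - x)\<bar> \<le> e * \<bar>y - x\<bar>"
    if "x \<in> I" "y \<in> I" "dist x a < r" "dist y a < r" for x y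
  proof -
    have "norm ((\<phi> y - \<phi>' a * y) - (\<phi> x - \<phi>' a * x)) \<le> e * norm (y - x)"
    proof (rule field_differentiable_bound[where S = "I \<inter> ball a r" and f' = "\<lambda>z. \<phi>' z - \<phi>' a"])
      show "convex (I \<inter> ball a r)"
        using assms(1) by (auto simp: proper_interval_def is_interval_convex_1 intro!: convex_Int)
      fix z assume z: "z \<in> I \<inter> ball a r"
      then have "(\<phi> has_real_derivative \<phi>' z) (at z within I \<inter> ball a r)"
        using d DERIV_subset by blast
      then show "((\<lambda>z. \<phi> z - \<phi>' a * z) has_real_derivative \<phi>' z - \<phi>' a) (at z within I \<inter> ball a r)"
        by (auto intro!: derivative_eq_intros)
      show "norm (\<phi>' z - \<phi>' a) \<le> e"
        using z r[of z] by (auto simp: dist_norm norm_minus_commute less_imp_le)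
    qed (use that in \<open>auto simp: dist_commute\<close>)
    then show ?thesis
      by (simp add: algebra_simps)
  qed
  with \<open>r > 0\<close> a show ?thesis
    using that by metis
qed

text \<open>
  Divide \<open>G (\<phi> x) - \<phi> x = \<phi> (F x) - \<phi> x\<close> by \<open>(x - a) ^ k\<close>: strict differentiability of \<open>\<phi>\<close> turns the
  limit \<open>c\<close> into \<open>s c\<close>, where \<open>s\<close> is the slope of \<open>\<phi>\<close> at \<open>a\<close>. Passing from \<open>(x - a) ^ k\<close> to
  \<open>(\<phi> x - b) ^ k\<close> costs a factor \<open>s ^ k\<close>. This gives the limit along the image filter of \<open>\<phi>\<close>, and
  the expansion of \<open>G\<close> extends it to all of \<open>J\<close>.
\<close>
lemma contact_with_identity_transport:
  assumes "proper_interval I" "proper_interval J" "a \<in> I" "b \<in> J"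
    and F: "F \<in> I \<rightarrow> I" "continuous_on I F" "F a = a"
    and G: "G \<in> Ck_on k J" "G b = b" "k \<ge> 2"
    and \<phi>: "\<phi> \<in> Ck_on 1 I" "\<phi> \<in> I \<rightarrow> J" "\<phi> a = b" "nth_deriv_on I 1 \<phi> a \<noteq> 0"
    and conj: "\<And>x. x \<in> I \<Longrightarrow> G (\<phi> x) = \<phi> (F x)"
    and contact: "((\<lambda>x. (F x - x) / (x - a) ^ k) \<longlongrightarrow> c) (at a within I)"
  shows "((\<lambda>y. (G y - y) / (y - b) ^ k) \<longlongrightarrow> nth_deriv_on I 1 \<phi> a * c / nth_deriv_on I 1 \<phi> a ^ k)
           (at b within J)"
proof -
  define s where "s = nth_deriv_on I 1 \<phi> a"
  let ?E = "filtermap \<phi> (at a within I)"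
  obtain \<phi>' where "\<And>x. x \<in> I \<Longrightarrow> (\<phi> has_real_derivative \<phi>' x) (at x within I)"
    using \<phi>(1) Ck_on_Suc_iff[OF assms(1), of \<phi> 0] unfolding One_nat_def by blast
  then have "(\<phi> has_real_derivative s) (at a within I)"
    using nth_deriv_on_Suc_eq[OF assms(1,3), of \<phi> \<phi>' 0] assms(3) unfolding s_def by simp
  then have slope: "((\<lambda>x. (\<phi> x - b) / (x - a)) \<longlongrightarrow> s) (at a within I)"
    unfolding has_field_derivative_iff \<phi>(3) .
  have in_I: "\<forall>\<^sub>F x in at a within I. x \<in> I \<and> x \<noteq> a"
    by (simp add: eventually_at_filter)
  have "\<forall>\<^sub>F x in at a within I. (\<phi> x - b) / (x - a) \<noteq> 0"
    using slope \<phi>(4) tendsto_imp_eventually_ne unfolding s_def by blast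
  then have ne: "\<forall>\<^sub>F x in at a within I. \<phi> x \<noteq> b"
    by eventually_elim auto
  have "?E \<le> at b within J"
  proof -
    have "(\<phi> \<longlongrightarrow> b) (at a within I)"
      using Ck_on_imp_continuous_on[OF \<phi>(1)] assms(3) \<phi>(3) by (auto simp: continuous_on)
    moreover have "\<forall>\<^sub>F x in at a within I. \<phi> x \<in> J \<and> \<phi> x \<noteq> b"
      using in_I ne by eventually_elim (use \<phi>(2) in auto)
    ultimately have "filterlim \<phi> (at b within J) (at a within I)"
      by (auto simp: filterlim_at)
    then show ?thesis by (simp add: filterlim_def)
  qed
  moreover have "?E \<noteq> bot"
    using at_within_proper_interval_neq_bot[OF assms(1,3)] by (simp add: filtermap_bot_iff)
  moreover have "((\<lambda>y. (G y - y) / (y - b) ^ k) \<longlongrightarrow> s * c / s ^ k) ?E"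
  proof -
    have "((\<lambda>x. (\<phi> (F x) - \<phi> x - s * (F x - x)) / (x - a) ^ k) \<longlongrightarrow> 0) (at a within I)"
      unfolding tendsto_iff
    proof (intro allI impI)
      fix e :: real assume "e > 0"
      \<comment> \<open>Near \<open>a\<close>, \<open>\<bar>F x - x\<bar>\<close> is less than \<open>(\<bar>c\<bar> + 1) * \<bar>x - a\<bar> ^ k\<close>.\<close>
      define e' where "e' = e / (\<bar>c\<bar> + 1)"
      have "e' > 0" using \<open>e > 0\<close> by (simp add: e'_def)
      then obtain d where "d > 0" and d: "\<And>x y. \<lbrakk>x \<in> I; y \<in> I; dist x a < d; dist y a < d\<rbrakk> \<Longrightarrow>
          \<bar>\<phi> y - \<phi> x - s * (y - x)\<bar> \<le> e' * \<bar>y - x\<bar>"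
        using strict_differentiability_within[OF assms(1,3) \<phi>(1)] unfolding s_def by metis
      have "(F \<longlongrightarrow> a) (at a within I)"
        using F(2,3) assms(3) by (auto simp: continuous_on)
      then have "\<forall>\<^sub>F x in at a within I. dist (F x) a < d"
        using \<open>d > 0\<close> by (rule tendstoD)
      moreover have "\<forall>\<^sub>F x in at a within I. dist x a < d"
        using \<open>d > 0\<close> tendstoD[OF tendsto_ident_at] by blast
      moreover have "\<forall>\<^sub>F x in at a within I. \<bar>(F x - x) / (x - a) ^ k\<bar> < \<bar>c\<bar> + 1"
        using order_tendstoD(2)[OF tendsto_rabs[OF contact]] by simp
      ultimately show "\<forall>\<^sub>F x in at a within I.
          dist ((\<phi> (F x) - \<phi> x - s * (F x - x)) / (x - a) ^ k) 0 < e"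
        using in_I
      proof eventually_elim
        case (elim x)
        then have "\<bar>\<phi> (F x) - \<phi> x - s * (F x - x)\<bar> \<le> e' * \<bar>F x - x\<bar>"
          using F(1) by (intro d) auto
        then have "\<bar>(\<phi> (F x) - \<phi> x - s * (F x - x)) / (x - a) ^ k\<bar> \<le> e' * \<bar>(F x - x) / (x - a) ^ k\<bar>"
          using elim by (simp add: abs_divide divide_right_mono)
        also have "\<dots> < e' * (\<bar>c\<bar> + 1)"
          using elim \<open>e' > 0\<close> by (intro mult_strict_left_mono) auto
        also have "\<dots> = e"
          by (simp add: e'_def)
        finally show ?case by simp
      qed
    qed
    from tendsto_add[OF this tendsto_mult[OF tendsto_const contact, of s]]
    have "((\<lambda>x. (\<phi> (F x) - \<phi> x) / (x - a) ^ k) \<longlongrightarrow> s * c) (at a within I)"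
      by (simp add: add_divide_distrib[symmetric])
    from tendsto_divide[OF this tendsto_power[OF slope, of k]] \<phi>(4)
    have "((\<lambda>x. (\<phi> (F x) - \<phi> x) / (x - a) ^ k / ((\<phi> x - b) / (x - a)) ^ k) \<longlongrightarrow> s * c / s ^ k)
        (at a within I)"
      by (simp add: s_def)
    moreover have "\<forall>\<^sub>F x in at a within I. (\<phi> (F x) - \<phi> x) / (x - a) ^ k / ((\<phi> x - b) / (x - a)) ^ k
        = (G (\<phi> x) - \<phi> x) / (\<phi> x - b) ^ k"
      using in_I ne by eventually_elim (simp add: conj power_divide)
    ultimately show ?thesis
      unfolding filterlim_filtermap by (rule Lim_transform_eventually)
  qed
  ultimately have "nth_deriv_on J 1 G b = 1 \<and> (\<forall>i. 2 \<le> i \<and> i < k \<longrightarrow> nth_deriv_on J i G b = 0) \<and>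
      nth_deriv_on J k G b / fact k = s * c / s ^ k"
    using contact_with_identity_iff[OF assms(2,4) G, of ?E "s * c / s ^ k"] by simp
  then show ?thesis
    unfolding s_def[symmetric] contact_with_identity_iff[OF assms(2,4) G
        at_within_proper_interval_neq_bot[OF assms(2,4)] order_refl] .
qed

section \<open>Cyclic compositions\<close>

lemma cyclic_comp_conjugate:
  assumes "m < p"
  shows "cyclic_comp p f (Suc m mod p) (f m x) = f m (cyclic_comp p f m x)"
proof (cases "Suc m = p")
  case True
  then have "[m..<p] = [m]" "[0..<p] = [0..<m] @ [m]" "Suc m mod p = 0"
    by auto
  then show ?thesis
    by (simp add: cyclic_comp_def)
next
  case False
  then have "Suc m mod p = Suc m"
    using assms by simp
  then show ?thesis
    using assms by (simp add: cyclic_comp_def upt_conv_Cons[of m p])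
qed

text \<open>
  The index \<open>n mod p\<close> of the target interval differs from \<open>n\<close> only for \<open>n = p\<close>, where the composition
  re-enters the interval \<open>I 0\<close>.
\<close>
lemma Ck_on_fold:
  assumes "\<And>i. i < p \<Longrightarrow> proper_interval (I i)"
    and "\<And>i. i < p \<Longrightarrow> f i \<in> I i \<rightarrow> I (Suc i mod p)"
    and "\<And>i. i < p \<Longrightarrow> f i \<in> Ck_on s (I i)"
    and "m < p" "m \<le> n" "n \<le> p"
  shows "fold f [m..<n] \<in> Ck_on s (I m) \<and> fold f [m..<n] \<in> I m \<rightarrow> I (n mod p)"
  using assms(5,6)
proof (induction rule: dec_induct)
  case base
  then show ?case
    using Ck_on_ident[OF assms(1)[OF assms(4)]] assms(4) by (auto simp: id_def)
next
  case (step n)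
  then have "n < p" "n mod p = n" by auto
  moreover have "fold f [m..<Suc n] = (\<lambda>x. f n (fold f [m..<n] x))"
    using step by (auto simp: o_def)
  ultimately show ?case
    using step assms(2)[of n]
      Ck_on_compose[of "I m" "I n" "fold f [m..<n]" s "f n"] assms(1,3,4)
    by (simp add: Pi_iff)
qed

lemma Ck_on_cyclic_comp:
  assumes "\<And>i. i < p \<Longrightarrow> proper_interval (I i)"
    and "\<And>i. i < p \<Longrightarrow> f i \<in> I i \<rightarrow> I (Suc i mod p)"
    and "\<And>i. i < p \<Longrightarrow> f i \<in> Ck_on s (I i)"
    and "m < p"
  shows "cyclic_comp p f m \<in> Ck_on s (I m)" "cyclic_comp p f m \<in> I m \<rightarrow> I m"
proof -
  have "fold f [m..<p] \<in> Ck_on s (I m) \<and> fold f [m..<p] \<in> I m \<rightarrow> I 0"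
    using Ck_on_fold[where I = I and f = f and p = p and m = m and n = p, OF assms] assms(4) by auto
  moreover have "fold f [0..<m] \<in> Ck_on s (I 0) \<and> fold f [0..<m] \<in> I 0 \<rightarrow> I m"
    using Ck_on_fold[where I = I and f = f and p = p and m = 0 and n = m, OF assms(1-3)] assms(4)
    by auto
  moreover have "cyclic_comp p f m = (\<lambda>x. fold f [0..<m] (fold f [m..<p] x))"
    by (auto simp: cyclic_comp_def)
  moreover have "proper_interval (I m)" "proper_interval (I 0)"
    using assms(1,4) by auto
  ultimately show "cyclic_comp p f m \<in> Ck_on s (I m)" "cyclic_comp p f m \<in> I m \<rightarrow> I m"
    using Ck_on_compose[of "I m" "I 0" "fold f [m..<p]" s "fold f [0..<m]"] by auto
qed

theorem theorem3p4:
  fixes \<mu> p j :: nat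
    and I :: "nat \<Rightarrow> real set"
    and f :: "nat \<Rightarrow> real \<Rightarrow> real"
    and a :: "nat \<Rightarrow> real"
  assumes "\<mu> \<ge> 2" and "p > 0"
    and "\<And>i. i < p \<Longrightarrow> proper_interval (I i)"
    and "\<And>i. i < p \<Longrightarrow> f i \<in> I i \<rightarrow> I (Suc i mod p)"
    and "\<And>i. i < p \<Longrightarrow> f i \<in> Ck_on (\<mu> + 1) (I i)"
    and "j < p"
    and "\<And>m. m < p \<Longrightarrow> a m \<in> I m"
    and "\<And>m. m < p \<Longrightarrow> a (Suc m mod p) = f m (a m)"
    and "\<And>m. m < p \<Longrightarrow> cyclic_comp p f m (a m) = a m"
    and "nth_deriv_on (I j) 1 (cyclic_comp p f j) (a j)
           = (\<Prod>i<p. nth_deriv_on (I i) 1 (f i) (a i))"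
    and "(\<Prod>i<p. nth_deriv_on (I i) 1 (f i) (a i)) = 1"
    and "\<And>i. 2 \<le> i \<Longrightarrow> i \<le> \<mu> \<Longrightarrow> nth_deriv_on (I j) i (cyclic_comp p f j) (a j) = 0"
    and "nth_deriv_on (I j) (\<mu> + 1) (cyclic_comp p f j) (a j) \<noteq> 0"
  shows "\<forall>m<p. (\<forall>i. 2 \<le> i \<and> i \<le> \<mu> \<longrightarrow> nth_deriv_on (I m) i (cyclic_comp p f m) (a m) = 0)
             \<and> nth_deriv_on (I m) (\<mu> + 1) (cyclic_comp p f m) (a m) \<noteq> 0"
proof -
  define k where "k = \<mu> + 1"
  define F where "F = cyclic_comp p f"
  note I = assms(3) and maps = assms(4) and smooth = assms(5)
  have "k \<ge> 2"
    using assms(1) by (simp add: k_def)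
  have F_Ck: "F m \<in> Ck_on k (I m)" and F_maps: "F m \<in> I m \<rightarrow> I m" if "m < p" for m
    unfolding F_def k_def using Ck_on_cyclic_comp[of p I f "\<mu> + 1", OF I maps smooth that] by simp_all
  have F_fix: "F m (a m) = a m" if "m < p" for m
    using assms(9)[OF that] by (simp add: F_def)
  have iff: "((\<lambda>x. (F m x - x) / (x - a m) ^ k) \<longlongrightarrow> c) (at (a m) within I m) \<longleftrightarrow>
      nth_deriv_on (I m) 1 (F m) (a m) = 1 \<and>
      (\<forall>i. 2 \<le> i \<and> i < k \<longrightarrow> nth_deriv_on (I m) i (F m) (a m) = 0) \<and>
      nth_deriv_on (I m) k (F m) (a m) / fact k = c" if "m < p" for m c
    by (rule contact_with_identity_iff[OF I[OF that] assms(7)[OF that] F_Ck[OF that] F_fix[OF that]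
          \<open>k \<ge> 2\<close> at_within_proper_interval_neq_bot[OF I[OF that] assms(7)[OF that]] order_refl])
  have slope_ne: "nth_deriv_on (I m) 1 (f m) (a m) \<noteq> 0" if "m < p" for m
    using assms(11) that prod_zero_iff[of "{..<p}" "\<lambda>i. nth_deriv_on (I i) 1 (f i) (a i)"] by auto
  define P where "P m \<longleftrightarrow>
    (\<exists>c\<noteq>0. ((\<lambda>x. (F m x - x) / (x - a m) ^ k) \<longlongrightarrow> c) (at (a m) within I m))" for m
  have step: "P (Suc m mod p)" if "m < p" "P m" for m
  proof -
    have m': "Suc m mod p < p"
      using assms(2) by simp
    from \<open>P m\<close> obtain c where "c \<noteq> 0"
      and c: "((\<lambda>x. (F m x - x) / (x - a m) ^ k) \<longlongrightarrow> c) (at (a m) within I m)"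
      unfolding P_def by blast
    have "f m \<in> Ck_on 1 (I m)"
      using smooth[OF that(1)] Ck_on_mono by (metis le_add2)
    then have "((\<lambda>y. (F (Suc m mod p) y - y) / (y - a (Suc m mod p)) ^ k) \<longlongrightarrow>
        nth_deriv_on (I m) 1 (f m) (a m) * c / nth_deriv_on (I m) 1 (f m) (a m) ^ k)
        (at (a (Suc m mod p)) within I (Suc m mod p))"
      using that(1) m' assms(8) cyclic_comp_conjugate[OF that(1), of f]
      by (intro contact_with_identity_transport[OF _ _ _ _ F_maps _ _ F_Ck] I assms(7) F_fix
            Ck_on_imp_continuous_on[OF F_Ck] \<open>k \<ge> 2\<close> maps slope_ne c) (auto simp: F_def)
    then show ?thesis
      unfolding P_def using slope_ne[OF that(1)] \<open>c \<noteq> 0\<close> by (intro exI conjI) auto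
  qed
  have "P j"
    unfolding P_def using iff[OF assms(6)] assms(10-13) by (auto simp: F_def k_def)
  have P_shift: "P ((j + n) mod p)" for n
  proof (induction n)
    case 0
    then show ?case using \<open>P j\<close> assms(6) by simp
  next
    case (Suc n)
    then show ?case
      using step[of "(j + n) mod p"] assms(2) by (simp add: mod_Suc_eq)
  qed
  have P_all: "P m" if "m < p" for m
  proof -
    have "(j + (p - j + m)) mod p = m"
      using that assms(6) by simp
    then show ?thesis
      using P_shift[of "p - j + m"] by simp
  qed
  have "(\<forall>i. 2 \<le> i \<and> i < k \<longrightarrow> nth_deriv_on (I m) i (F m) (a m) = 0) \<and>
      nth_deriv_on (I m) k (F m) (a m) \<noteq> 0" if "m < p" for m
  proof -
    have "P m"
      using that by (rule P_all)
    then obtain c where "c \<noteq> 0"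
      and "((\<lambda>x. (F m x - x) / (x - a m) ^ k) \<longlongrightarrow> c) (at (a m) within I m)"
      unfolding P_def by blast
    then show ?thesis
      using iff[OF that, of c] by auto
  qed
  then show ?thesis
    by (simp add: F_def k_def less_Suc_eq_le)
qed

end
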